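(* Let $k$ be a positive integer. An independence system $\mathcal{F}=(S,\mathcal{I})$ is $k$-circuit bounded if and only if, for any $k+1$ distinct circuits $C_1,\dots,C_{k+1}$ of $\mathcal{F}$ such that $e\in\bigcap_{i=1}^{k+1}C_i$ for some $e\in S$, the set $\big(\bigcup_{i=1}^{k+1}C_i\big)\setminus\{e\}$ contains a circuit.
   Context: An independence system $(S,\mathcal{I})$ is a finite set $S$ with a nonempty downward-closed family $\mathcal{I}\subseteq2^S$ of independent sets. Circuits are the inclusion-wise minimal non-independent sets. $k$-circuit bounded: for every $I\in\mathcal{I}$ and every $e\in S\setminus I$, the set $I\cup\{e\}$ contains at most $k$ distinct circuits. *)

theory Defs
  imports Main
begin

locale independence_system =
  fixes S :: "'a set" and \<I> :: "'a set set"
  assumes finite_ground: "finite S"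
    and indep_subset: "\<I> \<subseteq> Pow S"
    and indep_nonempty: "\<I> \<noteq> {}"
    and indep_down: "\<And>X Y. X \<in> \<I> \<Longrightarrow> Y \<subseteq> X \<Longrightarrow> Y \<in> \<I>"

definition circuit :: "'a set \<Rightarrow> 'a set set \<Rightarrow> 'a set \<Rightarrow> bool" where
  "circuit S \<I> C \<longleftrightarrow> C \<subseteq> S \<and> C \<notin> \<I> \<and> (\<forall>D. D \<subset> C \<longrightarrow> D \<in> \<I>)"

(* The counted set is finite whenever S is, since circuits are subsets of S. *)
definition circuit_bounded :: "nat \<Rightarrow> 'a set \<Rightarrow> 'a set set \<Rightarrow> bool" where
  "circuit_bounded k S \<I> \<longleftrightarrow>
     (\<forall>I\<in>\<I>. \<forall>e\<in>S - I. card {C. circuit S \<I> C \<and> C \<subseteq> I \<union> {e}} \<le> k)"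

end

theory Submission
  imports Defs
begin

text \<open>Both directions compare an independent set I plus one element e with a union of
  circuits. Given k+1 circuits through e, let I be their union without e. All of them lie in I
  \<union> {e}, so independence of I would break the bound; hence I is dependent and contains a
  circuit (\<open>dependent_contains_circuit\<close>). Conversely, if I is independent and I
  \<union> {e} contains k+1 circuits, each passes through e, since none fits inside I
  (\<open>circuit_not_subset_indep\<close>). Elimination of e then yields a circuit inside I, a
  contradiction.\<close>

context independence_system
begin

lemma circuit_not_subset_indep: "circuit S \<I> D \<Longrightarrow> X \<in> \<I> \<Longrightarrow> \<not> D \<subseteq> X"
  using indep_down by (auto simp: circuit_def)

lemma finite_circuits: "finite {C. circuit S \<I> C \<and> P C}"
  by (rule finite_subset[of _ "Pow S"]) (auto simp: circuit_def finite_ground)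

text \<open>Finiteness of S gives an inclusion-minimal dependent subset of X, and such a set is a
  circuit.\<close>

lemma dependent_contains_circuit:
  assumes "X \<subseteq> S" "X \<notin> \<I>"
  obtains D where "circuit S \<I> D" "D \<subseteq> X"
proof -
  let ?A = "{Y. Y \<subseteq> X \<and> Y \<notin> \<I>}"
  have "finite ?A"
    using finite_subset[OF assms(1) finite_ground] by simp
  moreover have "?A \<noteq> {}"
    using assms(2) by auto
  ultimately obtain D where D: "D \<in> ?A" and min: "\<forall>Y\<in>?A. Y \<subseteq> D \<longrightarrow> D = Y"
    by (rule finite_has_minimal[THEN bexE])
  have "circuit S \<I> D"
    unfolding circuit_def using D min assms(1) by blast
  with D that show thesis by blast
qed

end

theorem theorem16:
  fixes S :: "'a set" and \<I> :: "'a set set" and k :: nat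
  assumes "independence_system S \<I>" and "k > 0"
  shows "circuit_bounded k S \<I> \<longleftrightarrow>
    (\<forall>C :: nat \<Rightarrow> 'a set. \<forall>e\<in>S.
       inj_on C {1..k+1} \<and> (\<forall>i\<in>{1..k+1}. circuit S \<I> (C i)) \<and> e \<in> (\<Inter>i\<in>{1..k+1}. C i)
       \<longrightarrow> (\<exists>D. circuit S \<I> D \<and> D \<subseteq> (\<Union>i\<in>{1..k+1}. C i) - {e}))"
    (is "_ \<longleftrightarrow> ?R")
proof
  interpret independence_system S \<I> by fact
  {
    assume bounded: "circuit_bounded k S \<I>"
    show ?R
    proof (intro allI ballI impI, elim conjE)
      fix C :: "nat \<Rightarrow> 'a set" and e
      assume e: "e \<in> S" and inj: "inj_on C {1..k+1}"
        and circ: "\<forall>i\<in>{1..k+1}. circuit S \<I> (C i)"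
      define I where "I = (\<Union>i\<in>{1..k+1}. C i) - {e}"
      then have "e \<notin> I"
        by simp
      let ?F = "{D. circuit S \<I> D \<and> D \<subseteq> I \<union> {e}}"
      have "C ` {1..k+1} \<subseteq> ?F"
        using circ by (auto simp: I_def)
      \<comment> \<open>Injectivity of \<open>C\<close> makes the left side k+1. Finiteness of
        \<open>?F\<close> matters because \<open>card\<close> is 0 on infinite sets.\<close>
      then have "card (C ` {1..k+1}) \<le> card ?F"
        by (rule card_mono[OF finite_circuits])
      then have "\<not> card ?F \<le> k"
        unfolding card_image[OF inj] by simp
      then have "I \<notin> \<I>"
        using bounded e \<open>e \<notin> I\<close> unfolding circuit_bounded_def by blast
      moreover have "I \<subseteq> S"
        using circ by (auto simp: I_def circuit_def)
      ultimately obtain D where "circuit S \<I> D" "D \<subseteq> I"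
        using dependent_contains_circuit by blast
      then show "\<exists>D. circuit S \<I> D \<and> D \<subseteq> (\<Union>i\<in>{1..k+1}. C i) - {e}"
        unfolding I_def by blast
    qed
  next
    assume R: ?R
    show "circuit_bounded k S \<I>"
      unfolding circuit_bounded_def
    proof (intro ballI, rule ccontr)
      fix I e
      let ?F = "{D. circuit S \<I> D \<and> D \<subseteq> I \<union> {e}}"
      assume I: "I \<in> \<I>" and e: "e \<in> S - I" and "\<not> card ?F \<le> k"
      \<comment> \<open>More than k circuits allow a choice of exactly k+1, which are then
        enumerated to fit the indexed form of \<open>R\<close>.\<close>
      then obtain T where T: "T \<subseteq> ?F" "card T = k + 1" "finite T"
        using obtain_subset_with_card_n[of "k + 1" ?F] by (auto simp: not_le Suc_le_eq)
      then obtain C where C: "bij_betw C {1..k+1} T"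
        using ex_bij_betw_nat_finite_1[of T] by auto
      have mem: "C i \<in> ?F" if "i \<in> {1..k+1}" for i
        using bij_betwE[OF C] that T(1) by blast
      \<comment> \<open>A circuit within I \<union> {e} that avoided e would lie in the independent
        set I.\<close>
      have "e \<in> C i" if "i \<in> {1..k+1}" for i
        using mem[OF that] circuit_not_subset_indep[OF _ I, of "C i"] by auto
      then have "inj_on C {1..k+1} \<and> (\<forall>i\<in>{1..k+1}. circuit S \<I> (C i)) \<and> e \<in> (\<Inter>i\<in>{1..k+1}. C i)"
        using mem bij_betw_imp_inj_on[OF C] by simp
      then obtain D where D: "circuit S \<I> D" "D \<subseteq> (\<Union>i\<in>{1..k+1}. C i) - {e}"
        using R[rule_format, of e C] e by auto
      \<comment> \<open>Every \<open>C i\<close> lies in I \<union> {e}, so removing e from their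
        union leaves a subset of I.\<close>
      have "D \<subseteq> I"
        using D(2) mem by blast
      with circuit_not_subset_indep[OF D(1) I] show False by blast
    qed
  }
qed

end
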